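(* For any integer $n\geq 1$, $$N_{n}(t)=\left(\frac{1+yt}{1+y}\right)^{n+1}T_{n}^{(\mathrm{tc},\mathrm{nlc})}\left(\frac{(1+y)^{2}t}{(y+t)(1+yt)},\frac{y+t}{1+yt}\right).$$ Equivalently, $$T_{n}^{(\mathrm{tc},\mathrm{nlc})}(y,t)=\left(\frac{1+u}{1+uv}\right)^{n+1}N_{n}(v),$$ where $$u=\frac{1+t^{2}-2yt-(1-t)\sqrt{(1+t)^{2}-4yt}}{2(1-y)t},\qquad v=\frac{(1+t)^{2}-2yt-(1+t)\sqrt{(1+t)^{2}-4yt}}{2yt}.$$ Furthermore, $$T_{n}^{(\mathrm{tc},\mathrm{nlc})}(y,t)=\sum_{k=0}^{\lfloor (n-1)/2\rfloor}\frac{1}{k+1}\binom{2k}{k}\binom{n-1}{2k}y^{k+1}t^{k+1}(1+t)^{n-2k-1},$$ and the number of binary trees with $n$ nodes, $k$ nodes with two children, and $j$ nodes with no left children is $$\frac{1}{k+1}\binom{2k}{k}\binom{n-1}{2k}\binom{n-2k-1}{j-k-1}.$$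
   Context: A binary tree is a rooted tree in which each node has $0$, $1$ or $2$ children and each child is distinguished as a left child or a right child (each node having at most one left child and at most one right child). $\mathcal{T}_n$ is the set of binary trees with $n$ nodes. For a binary tree $T$, $\mathrm{nlc}(T)$ is the number of nodes of $T$ with no left child and $\mathrm{tc}(T)$ is the number of nodes of $T$ with two children. For $n\ge1$, $T_n^{(\mathrm{tc},\mathrm{nlc})}(y,t)=\sum_{T\in\mathcal{T}_n}y^{\mathrm{tc}(T)+1}t^{\mathrm{nlc}(T)}$, and the $n$th Narayana polynomial is $N_n(t)=\frac1n\sum_{k=1}^n\binom nk\binom n{k-1}t^k$. Binomial coefficients $\binom ab$ are $0$ when $b<0$ or when $0\le a<b$. Here $y,t$ are indeterminates; the first identity is an identity of rational functions in $y,t$. In the second identity, $\sqrt{(1+t)^2-4yt}$ is the formal power series in $t$ over $\mathbb{Q}[y]$ with constant term $1$, so that $u$ and $v$ are formal power series in $t$ with coefficients in $\mathbb{Q}[y]$. *)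

theory Defs
  imports "HOL-Library.Tree" "HOL-Computational_Algebra.Computational_Algebra"
begin

section \<open>Binary trees\<close>

text \<open>
  The nodes of a binary tree are the \<^const>\<open>Node\<close>s of a \<^typ>\<open>unit tree\<close>; a \<^const>\<open>Leaf\<close> stands
  for an absent child and \<^const>\<open>size\<close> counts the nodes.
\<close>

definition binary_trees :: "nat \<Rightarrow> unit tree set" where
  "binary_trees n = {T. size T = n}"

fun nlc :: "'a tree \<Rightarrow> nat" where
  "nlc Leaf = 0"
| "nlc (Node l x r) = (if l = Leaf then 1 else 0) + nlc l + nlc r"

fun tc :: "'a tree \<Rightarrow> nat" where
  "tc Leaf = 0"
| "tc (Node l x r) = (if l \<noteq> Leaf \<and> r \<noteq> Leaf then 1 else 0) + tc l + tc r"

lemma finite_binary_trees: "finite (binary_trees n)"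
proof (induction n rule: less_induct)
  case (less n)
  have "binary_trees n \<subseteq>
    insert Leaf ((\<lambda>(l, r). Node l () r) ` ((\<Union>i<n. binary_trees i) \<times> (\<Union>i<n. binary_trees i)))"
  proof
    fix T assume "T \<in> binary_trees n"
    then show "T \<in> insert Leaf
        ((\<lambda>(l, r). Node l () r) ` ((\<Union>i<n. binary_trees i) \<times> (\<Union>i<n. binary_trees i)))"
      by (cases T) (auto simp: binary_trees_def image_iff)
  qed
  then show ?case
    using less by (auto intro: finite_subset)
qed

section \<open>The two polynomials\<close>

definition tree_poly :: "nat \<Rightarrow> 'a \<Rightarrow> 'a \<Rightarrow> 'a::comm_semiring_1" where
  "tree_poly n y t = (\<Sum>T\<in>binary_trees n. y ^ (tc T + 1) * t ^ nlc T)"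

definition narayana :: "nat \<Rightarrow> 'a \<Rightarrow> 'a::field_char_0" where
  "narayana n t = 1 / of_nat n * (\<Sum>k=1..n. of_nat (n choose k) * of_nat (n choose (k - 1)) * t ^ k)"

text \<open>
  On \<^typ>\<open>nat\<close>, subtraction in the lower argument of \<^const>\<open>binomial\<close> would truncate to \<open>0\<close>, giving \<open>1\<close>
  where the convention for negative lower arguments demands \<open>0\<close>.
\<close>

definition int_binomial :: "int \<Rightarrow> int \<Rightarrow> rat" where
  "int_binomial a b = (if b < 0 then 0 else of_int a gchoose nat b)"

section \<open>The field of rational functions in two indeterminates\<close>

instance fract :: ("{idom, ring_char_0}") field_char_0
proof
  have "of_nat n = to_fract (of_nat n :: 'a)" for n
    by (induction n) auto
  then show "inj (of_nat :: nat \<Rightarrow> 'a fract)"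
    by (simp add: inj_def)
qed

text \<open>
  In \<^typ>\<open>rat poly poly\<close> the inner indeterminate is \<open>y\<close> and the outer one is \<open>t\<close>.
\<close>

definition ratfun_y :: "rat poly poly fract" where
  "ratfun_y = to_fract [:[:0, 1:]:]"

definition ratfun_t :: "rat poly poly fract" where
  "ratfun_t = to_fract [:0, 1:]"

section \<open>Power series in \<open>t\<close> over the polynomials in \<open>y\<close>\<close>

text \<open>
  Power series in \<open>t\<close> over \<open>\<rat>[y]\<close> are embedded into the field of Laurent series in \<open>t\<close> over \<open>\<rat>(y)\<close>,
  in which the quotients defining \<open>u\<close> and \<open>v\<close> are ordinary field quotients.
\<close>

definition embed_series :: "rat poly fps \<Rightarrow> rat poly fract fls" where
  "embed_series f = fps_to_fls (Abs_fps (\<lambda>i. to_fract (fps_nth f i)))"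

definition ser_y :: "rat poly fract fls" where
  "ser_y = embed_series (fps_const [:0, 1:])"

definition ser_t :: "rat poly fract fls" where
  "ser_t = embed_series fps_X"

definition fps_sqrt1 :: "rat poly fps \<Rightarrow> rat poly fps" where
  "fps_sqrt1 f = (THE s. s ^ 2 = f \<and> fps_nth s 0 = 1)"

lemma fps_sqrt1_unique_existence:
  fixes f :: "rat poly fps"
  assumes f: "fps_nth f 0 = 1"
  shows "\<exists>!s. s ^ 2 = f \<and> fps_nth s 0 = 1"
proof -
  define b :: "rat fps" where "b = fps_binomial (1 / 2)"
  define B :: "rat poly fps" where "B = Abs_fps (\<lambda>i. [:fps_nth b i:])"
  have b2: "b * b = 1 + fps_X"
    by (simp add: b_def fps_binomial_add_mult [symmetric] fps_binomial_1)
  have B2: "B * B = 1 + fps_X"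
  proof (rule fps_ext)
    fix i
    have sum_pCons: "(\<Sum>j\<in>A. [:g j:]) = [:\<Sum>j\<in>A. g j:]" for A and g :: "nat \<Rightarrow> rat"
      by (induction A rule: infinite_finite_induct) auto
    have "fps_nth (B * B) i = [:fps_nth (b * b) i:]"
      by (simp add: B_def fps_mult_nth sum_pCons mult.commute)
    then show "fps_nth (B * B) i = fps_nth (1 + fps_X) i"
      by (simp add: b2 fps_X_def)
  qed
  define s where "s = B oo (f - 1)"
  have "s * s = (B * B) oo (f - 1)"
    using f by (simp add: s_def fps_compose_mult_distrib)
  also have "\<dots> = f"
    using f by (simp add: B2 fps_compose_add_distrib)
  finally have s: "s ^ 2 = f \<and> fps_nth s 0 = 1"
    by (simp add: s_def power2_eq_square B_def b_def)
  moreover have "s' = s" if "s' ^ 2 = f \<and> fps_nth s' 0 = 1" for s'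
  proof -
    have "(s' - s) * (s' + s) = 0"
      using s that by (simp add: algebra_simps power2_eq_square)
    moreover have "fps_nth (s' + s) 0 \<noteq> 0"
      using s that by simp
    then have "s' + s \<noteq> 0"
      by (metis fps_zero_nth)
    ultimately show ?thesis
      by simp
  qed
  ultimately show ?thesis
    by blast
qed

definition ser_sqrt :: "rat poly fract fls" where
  "ser_sqrt = embed_series
     (fps_sqrt1 ((1 + fps_X) ^ 2 - 4 * fps_const [:0, 1:] * fps_X))"

definition ser_u :: "rat poly fract fls" where
  "ser_u = (1 + ser_t ^ 2 - 2 * ser_y * ser_t - (1 - ser_t) * ser_sqrt)
           / (2 * (1 - ser_y) * ser_t)"

definition ser_v :: "rat poly fract fls" where
  "ser_v = ((1 + ser_t) ^ 2 - 2 * ser_y * ser_t - (1 + ser_t) * ser_sqrt)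
           / (2 * ser_y * ser_t)"

end

theory Submission
  imports Defs
begin

text \<open>
  Removing the root turns the weighted count of binary trees into a quadratic equation for its
  generating function, whose solution is \<open>t E C(y t E\<^sup>2)\<close> with \<open>C\<close> the Catalan series and
  \<open>E = X / (1 - (1 + t) X)\<close>; this gives the closed form. At \<open>y = 1\<close> Vandermonde's identity
  collapses its coefficients to the Narayana numbers. In the closed form \<open>y\<close> and \<open>t\<close> enter only
  through \<open>y t\<close> and \<open>1 + t\<close>, and the substitution multiplies the values \<open>v\<close> and \<open>1 + v\<close> of these
  at \<open>(1, v)\<close> by \<open>q\<^sup>2\<close> and \<open>q = (1 + u) / (1 + u v)\<close>, so that \<open>q ^ (n + 1)\<close> factors out.
\<close>

section \<open>Catalan series and its quadratic equation\<close>

definition catalan_fps :: "'a::field_char_0 fps" where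
  "catalan_fps = Abs_fps (\<lambda>k. of_nat ((2 * k) choose k) / of_nat (k + 1))"

text \<open>The ratio of consecutive Catalan numbers, read off from
  \<open>(2k choose k) * k! * k! = (2k)!\<close>. With denominators cleared it is the coefficient
  form of the differential equation for \<open>H\<close> below.\<close>

lemma catalan_fps_nth_Suc:
  "(of_nat k + 2) * fps_nth catalan_fps (Suc k) =
    (4 * of_nat k + 2) * (fps_nth catalan_fps k :: 'a::field_char_0)"
proof -
  have central: "((2 * k) choose k) * (fact k * fact k) = (fact (2 * k) :: nat)" for k
    using binomial_fact_lemma[of k "2 * k"] by (simp add: mult_ac mult_2)
  have "Suc k * (Suc k * (((2 * Suc k) choose Suc k) * (fact k * fact k))) = (fact (2 * Suc k) :: nat)"
    using central[of "Suc k"] by (simp add: algebra_simps)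
  also have "\<dots> = (2 * k + 2) * (2 * k + 1) * (((2 * k) choose k) * (fact k * fact k))"
    by (simp only: central) (simp add: algebra_simps)
  finally have "(Suc k * ((2 * Suc k) choose Suc k)) * (Suc k * (fact k * fact k)) =
      ((4 * k + 2) * ((2 * k) choose k)) * (Suc k * (fact k * fact k))"
    by (simp add: algebra_simps del: binomial_Suc_Suc)
  then have "Suc k * ((2 * Suc k) choose Suc k) = (4 * k + 2) * ((2 * k) choose k)"
    by (subst (asm) mult_right_cancel) (simp_all del: binomial_Suc_Suc)
  then have "of_nat (Suc k * ((2 * Suc k) choose Suc k)) =
      (of_nat ((4 * k + 2) * ((2 * k) choose k)) :: 'a)"
    by (rule arg_cong)
  then have "(of_nat k + 1) * (of_nat ((2 * Suc k) choose Suc k) :: 'a) =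
      (4 * of_nat k + 2) * of_nat ((2 * k) choose k)"
    by (simp add: algebra_simps del: binomial_Suc_Suc)
  moreover have "(of_nat k + 1 :: 'a) \<noteq> 0" "(of_nat k + 2 :: 'a) \<noteq> 0"
    by (metis of_nat_Suc of_nat_neq_0 add.commute)
       (metis of_nat_add of_nat_numeral of_nat_eq_0_iff add_is_0 zero_neq_numeral)
  ultimately show ?thesis
    by (simp add: catalan_fps_def field_simps del: binomial_Suc_Suc)
qed

text \<open>
  With \<open>H = 1 - 2 X C\<close>, the recurrence of the coefficients says \<open>(1 - 4 X) H' = - 2 H\<close>, so
  \<open>H\<^sup>2 / (1 - 4 X)\<close> is constant.
\<close>

lemma catalan_fps_eq:
  "catalan_fps = 1 + fps_X * (catalan_fps :: 'a::field_char_0 fps) ^ 2"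
proof -
  define C where "C = (catalan_fps :: 'a fps)"
  define H where "H = 1 - 2 * fps_X * C"
  define Q :: "'a fps" where "Q = 1 - 4 * fps_X"
  have ode: "Q * fps_deriv H = - 2 * H"
  proof (rule fps_ext)
    fix k
    have Q: "Q * f = f - fps_const 4 * (fps_X * f)" for f
      by (simp add: Q_def numeral_fps_const algebra_simps)
    have "H = 1 - fps_const 2 * (fps_X * C)"
      by (simp add: H_def numeral_fps_const mult.assoc)
    then have H: "fps_nth H 0 = 1" "fps_nth H (Suc j) = - 2 * fps_nth C j" for j
      by simp_all
    have R: "- 2 * H = fps_const (- 2) * H"
      by (simp add: numeral_fps_const)
    show "fps_nth (Q * fps_deriv H) k = fps_nth (- 2 * H) k"
    proof (cases k)
      case 0
      then show ?thesis
        by (simp add: Q R H) (simp add: C_def catalan_fps_def)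
    next
      case (Suc j)
      have "fps_nth (Q * fps_deriv H) k - fps_nth (- 2 * H) k =
          - 2 * ((of_nat j + 2) * fps_nth C (Suc j) - (4 * of_nat j + 2) * fps_nth C j)"
        unfolding Q R by (simp add: Suc H algebra_simps)
      also have "\<dots> = 0"
        by (simp add: C_def catalan_fps_nth_Suc)
      finally show ?thesis
        by (simp only: right_minus_eq)
    qed
  qed
  have Q0: "fps_nth Q 0 = 1" and H0: "fps_nth H 0 = 1"
    by (simp_all add: Q_def H_def)
  have inv: "Q * inverse Q = 1"
    using Q0 by (simp add: inverse_mult_eq_1')
  have dQ: "fps_deriv Q = - 4"
    by (simp add: Q_def numeral_fps_const)
  \<comment> \<open>The factor \<open>Q ^ 2\<close> pairs every \<open>inverse Q\<close> with a
    \<open>Q\<close>; it can be cancelled afterwards because \<open>Q\<close> is nonzero.\<close>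
  have "fps_deriv (H ^ 2 * inverse Q) * Q ^ 2 = 0"
  proof -
    have "fps_deriv (inverse Q) = - fps_deriv Q * inverse Q ^ 2"
      using Q0 by (simp add: fps_inverse_deriv)
    then have "fps_deriv (H ^ 2 * inverse Q) * Q ^ 2 =
        2 * H * (Q * fps_deriv H) * (Q * inverse Q) + 4 * H ^ 2 * (Q * inverse Q) ^ 2"
      by (simp add: dQ algebra_simps power2_eq_square)
    then show ?thesis
      by (simp add: inv ode algebra_simps power2_eq_square)
  qed
  moreover have "Q \<noteq> 0"
    using Q0 by auto
  ultimately have "fps_deriv (H ^ 2 * inverse Q) = 0"
    by simp
  then have "H ^ 2 * inverse Q = fps_const (fps_nth (H ^ 2 * inverse Q) 0)"
    by (simp only: fps_deriv_eq_0_iff)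
  also have "\<dots> = 1"
    by (simp add: H0 Q0 power2_eq_square)
  finally have const: "H ^ 2 * inverse Q = 1" .
  have "H ^ 2 = H ^ 2 * (Q * inverse Q)"
    by (simp only: inv mult_1_right)
  also have "\<dots> = Q * (H ^ 2 * inverse Q)"
    by (simp only: mult_ac)
  also have "\<dots> = Q"
    by (simp only: const mult_1_right)
  finally have "H ^ 2 = Q" .
  \<comment> \<open>Expanding \<open>(1 - 2 X C)^2 = 1 - 4 X\<close> gives the claim multiplied by
    \<open>4 X\<close>.\<close>
  then have "4 * fps_X * C = 4 * fps_X * (1 + fps_X * C ^ 2)"
    by (simp add: H_def Q_def power2_eq_square algebra_simps)
  moreover have "4 * fps_X \<noteq> (0 :: 'a fps)"
    by simp
  ultimately show ?thesis
    unfolding C_def by (metis mult_left_cancel)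
qed

text \<open>Since \<open>E = X / (1 - s X)\<close> satisfies \<open>E = X (1 + s E)\<close>, the
  coefficients of its powers obey Pascal's rule with weight \<open>s\<close>.\<close>

lemma geometric_fps_power_nth:
  fixes s :: "'a::field_char_0"
  shows "fps_nth ((fps_X * inverse (1 - fps_const s * fps_X)) ^ Suc m) (Suc n) =
    of_nat (n choose m) * s ^ (n - m)"
proof -
  define E where "E = fps_X * inverse (1 - fps_const s * fps_X)"
  have "(1 - fps_const s * fps_X) * inverse (1 - fps_const s * fps_X) = 1"
    by (simp add: inverse_mult_eq_1')
  then have "E * (1 - fps_const s * fps_X) = fps_X"
    unfolding E_def by (metis mult.assoc mult.commute mult_1_right)
  then have E: "E = fps_X * (1 + fps_const s * E)"
    by (simp add: algebra_simps)
  have E0: "fps_nth E 0 = 0"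
    by (simp add: E_def)
  have step: "fps_nth (E ^ Suc m) (Suc n) = fps_nth (E ^ m) n + s * fps_nth (E ^ Suc m) n" for m n
  proof -
    have "E ^ Suc m = fps_X * (1 + fps_const s * E) * E ^ m"
      unfolding power_Suc by (rule arg_cong[OF E])
    also have "\<dots> = fps_X * (E ^ m + fps_const s * E ^ Suc m)"
      by (simp add: algebra_simps)
    finally show ?thesis
      by (metis fps_X_mult_nth fps_add_nth fps_mult_left_const_nth diff_Suc_1 nat.distinct(1))
  qed
  have "fps_nth (E ^ Suc m) (Suc n) = of_nat (n choose m) * s ^ (n - m)"
  proof (induction n arbitrary: m)
    case 0
    show ?case
      using step[of m 0] E0 by (cases m) simp_all
  next
    case (Suc n)
    show ?case
    proof (cases m)
      case 0
      with Suc[of 0] step[of 0 "Suc n"] show ?thesis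
        by simp
    next
      case (Suc l)
      \<comment> \<open>For \<open>l \<ge> n\<close> the exponents truncate to 0, but then the
        binomial coefficient is 0.\<close>
      have "s * (of_nat (n choose Suc l) * s ^ (n - Suc l)) = of_nat (n choose Suc l) * s ^ (n - l)"
        by (cases "l < n") (auto simp: Suc_diff_Suc[symmetric] not_less binomial_eq_0)
      with Suc Suc.IH[of l] Suc.IH[of "Suc l"] step[of "Suc l" "Suc n"] show ?thesis
        by (simp add: algebra_simps)
    qed
  qed
  then show ?thesis
    by (simp add: E_def)
qed

section \<open>Generating function of binary trees\<close>

text \<open>The exponent is \<open>tc T\<close>, not \<open>tc T + 1\<close>, so that the weights of
  the two subtrees multiply up to a factor from the root.\<close>

definition tree_weight :: "'a \<Rightarrow> 'a \<Rightarrow> unit tree \<Rightarrow> 'a::comm_semiring_1" where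
  "tree_weight y t T = y ^ tc T * t ^ nlc T"

text \<open>The empty tree is left out: the series 1 then stands for an absent child and
  \<open>tree_fps\<close> for a present one.\<close>

definition tree_fps :: "'a \<Rightarrow> 'a \<Rightarrow> 'a::field_char_0 fps" where
  "tree_fps y t = Abs_fps (\<lambda>n. if n = 0 then 0 else sum (tree_weight y t) (binary_trees n))"

lemma binary_trees_Suc:
  "binary_trees (Suc n) =
    (\<Union>i\<in>{0..n}. (\<lambda>(l, r). Node l () r) ` (binary_trees i \<times> binary_trees (n - i)))"
proof (intro set_eqI iffI)
  fix T assume "T \<in> binary_trees (Suc n)"
  then show "T \<in> (\<Union>i\<in>{0..n}. (\<lambda>(l, r). Node l () r) ` (binary_trees i \<times> binary_trees (n - i)))"
    by (cases T) (auto simp: binary_trees_def image_iff)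
qed (auto simp: binary_trees_def)

lemma binary_trees_0: "binary_trees 0 = {Leaf}"
  by (auto simp: binary_trees_def)

text \<open>
  The four summands account for a root with no child, only a right child, only a left child, and
  two children.
\<close>

lemma tree_weight_Node_sum:
  fixes y t :: "'a::field_char_0"
  shows "(\<Sum>l\<in>binary_trees i. \<Sum>r\<in>binary_trees j. tree_weight y t (Node l () r)) =
    t * fps_nth 1 i * fps_nth 1 j + t * fps_nth 1 i * fps_nth (tree_fps y t) j
    + fps_nth (tree_fps y t) i * fps_nth 1 j
    + y * fps_nth (tree_fps y t) i * fps_nth (tree_fps y t) j"
proof -
  have nz: "x = Leaf \<longleftrightarrow> k = 0" if "x \<in> binary_trees k" for x k
    using that by (auto simp: binary_trees_def)
  have "(\<Sum>l\<in>binary_trees i. \<Sum>r\<in>binary_trees j. tree_weight y t (Node l () r)) =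
    (\<Sum>l\<in>binary_trees i. \<Sum>r\<in>binary_trees j. (if i = 0 then t else 1)
       * (if i \<noteq> 0 \<and> j \<noteq> 0 then y else 1) * (tree_weight y t l * tree_weight y t r))"
    by (intro sum.cong refl) (auto simp: tree_weight_def nz power_add)
  also have "\<dots> = (if i = 0 then t else 1) * (if i \<noteq> 0 \<and> j \<noteq> 0 then y else 1)
      * (sum (tree_weight y t) (binary_trees i) * sum (tree_weight y t) (binary_trees j))"
    by (subst sum_product) (simp only: sum_distrib_left)
  finally show ?thesis
    by (auto simp: tree_fps_def binary_trees_0 tree_weight_def)
qed

text \<open>\<open>X\<close> marks the root; summing the four kinds of root over all sizes of the
  left subtree yields Cauchy products.\<close>

lemma tree_fps_eq:
  fixes y t :: "'a::field_char_0"
  shows "tree_fps y t = fps_X * (fps_const t + fps_const (1 + t) * tree_fps y t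
    + fps_const y * tree_fps y t ^ 2)"
proof (rule fps_ext)
  fix m
  show "fps_nth (tree_fps y t) m = fps_nth (fps_X * (fps_const t + fps_const (1 + t) * tree_fps y t
    + fps_const y * tree_fps y t ^ 2)) m"
  proof (cases m)
    case 0
    then show ?thesis
      by (simp add: tree_fps_def)
  next
    case (Suc n)
    have "fps_nth (tree_fps y t) (Suc n) = sum (tree_weight y t) (binary_trees (Suc n))"
      by (simp add: tree_fps_def)
    also have "\<dots> = (\<Sum>i=0..n. sum (tree_weight y t)
        ((\<lambda>(l, r). Node l () r) ` (binary_trees i \<times> binary_trees (n - i))))"
      unfolding binary_trees_Suc
      using finite_binary_trees[unfolded binary_trees_def]
      by (intro sum.UNION_disjoint) (auto simp: binary_trees_def)
    also have "\<dots> = (\<Sum>i=0..n. \<Sum>l\<in>binary_trees i. \<Sum>r\<in>binary_trees (n - i).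
        tree_weight y t (Node l () r))"
      by (subst sum.reindex) (auto simp: inj_on_def sum.cartesian_product case_prod_beta)
    \<comment> \<open>The factors 1 stay so that each of the four products unfolds to a convolution
      over the same index.\<close>
    also have "\<dots> = fps_nth (fps_const t * 1 * 1 + fps_const t * 1 * tree_fps y t
        + tree_fps y t * 1 + fps_const y * tree_fps y t * tree_fps y t) n"
      unfolding tree_weight_Node_sum
      by (simp only: sum.distrib fps_add_nth fps_mult_nth[of _ _ n] fps_mult_left_const_nth)
    finally show ?thesis
      using Suc by (simp add: algebra_simps power2_eq_square flip: fps_const_add)
  qed
qed

text \<open>Subtracting the equations leaves \<open>F - G\<close> times a series with constant term
  1, and power series over a domain have no zero divisors.\<close>

lemma quadratic_fps_unique:
  fixes F G :: "'a::idom fps"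
  assumes F: "F = fps_X * (A + B * F + D * F ^ 2)"
    and G: "G = fps_X * (A + B * G + D * G ^ 2)"
  shows "F = G"
proof -
  have "F - G = fps_X * (A + B * F + D * F ^ 2) - fps_X * (A + B * G + D * G ^ 2)"
    using F G by simp
  then have "(F - G) * (1 - fps_X * (B + D * (F + G))) = 0"
    by (simp add: algebra_simps power2_eq_square)
  moreover have "fps_nth (1 - fps_X * (B + D * (F + G))) 0 \<noteq> 0"
    by simp
  then have "1 - fps_X * (B + D * (F + G)) \<noteq> 0"
    by (metis fps_zero_nth)
  ultimately show ?thesis
    by simp
qed

text \<open>By uniqueness it suffices that the right-hand side \<open>G\<close> solves the tree
  equation. With \<open>z = y t E^2\<close>, the Catalan equation \<open>C = 1 + z C^2\<close> turns
  \<open>t C\<close> into \<open>t + y G^2\<close>, and \<open>E (1 - (1 + t) X) = X\<close>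
  supplies the linear term.\<close>

lemma tree_fps_closed_form:
  fixes y t :: "'a::field_char_0"
  defines "E \<equiv> fps_X * inverse (1 - fps_const (1 + t) * fps_X)"
  shows "tree_fps y t = fps_const t * E * (catalan_fps oo (fps_const (y * t) * E ^ 2))"
proof (rule quadratic_fps_unique[OF tree_fps_eq])
  define z where "z = fps_const (y * t) * E ^ 2"
  define C where "C = catalan_fps oo z"
  define G where "G = fps_const t * E * C"
  have z0: "fps_nth z 0 = 0"
    by (simp add: z_def E_def power2_eq_square)
  have "C = (1 + fps_X * catalan_fps ^ 2) oo z"
    unfolding C_def by (subst catalan_fps_eq) (rule refl)
  also have "\<dots> = 1 + z * C ^ 2"
    using z0 by (simp add: C_def fps_compose_add_distrib fps_compose_mult_distrib power2_eq_square)
  finally have C: "C = 1 + z * C ^ 2" .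
  have "(1 - fps_const (1 + t) * fps_X) * inverse (1 - fps_const (1 + t) * fps_X) = 1"
    by (simp add: inverse_mult_eq_1')
  then have "E * (1 - fps_const (1 + t) * fps_X) = fps_X"
    unfolding E_def by (metis mult.assoc mult.commute mult_1_right)
  then have "G * (1 - fps_const (1 + t) * fps_X) = fps_X * (fps_const t * C)"
    by (simp add: G_def mult_ac)
  also have "fps_const t * C = fps_const t + fps_const y * G ^ 2"
    by (subst C) (simp add: G_def z_def algebra_simps power2_eq_square flip: fps_const_mult)
  finally have "G = fps_X * (fps_const t + fps_const (1 + t) * G + fps_const y * G ^ 2)"
    by (simp add: algebra_simps del: fps_const_add)
  then show "fps_const t * E * (catalan_fps oo (fps_const (y * t) * E ^ 2)) =
      fps_X * (fps_const t
        + fps_const (1 + t) * (fps_const t * E * (catalan_fps oo (fps_const (y * t) * E ^ 2)))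
        + fps_const y * (fps_const t * E * (catalan_fps oo (fps_const (y * t) * E ^ 2))) ^ 2)"
    by (simp add: G_def C_def z_def)
qed

text \<open>As \<open>b ^ k\<close> has no terms below degree \<open>k\<close>, the sum defining
  each coefficient of \<open>a oo b\<close> up to degree \<open>n\<close> may run to
  \<open>n\<close>; the range is then constant and the sums can be swapped.\<close>

lemma fps_mult_compose_nth:
  fixes a b w :: "'a::comm_ring_1 fps"
  assumes "fps_nth b 0 = 0"
  shows "fps_nth (w * (a oo b)) n = (\<Sum>k=0..n. fps_nth a k * fps_nth (w * b ^ k) n)"
proof -
  have "fps_nth (a oo b) j = (\<Sum>k=0..n. fps_nth a k * fps_nth (b ^ k) j)" if "j \<le> n" for j
    unfolding fps_compose_nth
    using that assms by (intro sum.mono_neutral_left) (auto simp: startsby_zero_power_prefix)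
  then have "fps_nth (w * (a oo b)) n =
      (\<Sum>i=0..n. \<Sum>k=0..n. fps_nth w i * (fps_nth a k * fps_nth (b ^ k) (n - i)))"
    by (simp add: fps_mult_nth sum_distrib_left)
  also have "\<dots> = (\<Sum>k=0..n. fps_nth a k * fps_nth (w * b ^ k) n)"
    by (subst sum.swap) (simp add: fps_mult_nth sum_distrib_left mult_ac)
  finally show ?thesis .
qed

section \<open>Closed form of the tree polynomial\<close>

lemma tree_poly_closed_form:
  fixes y t :: "'a::field_char_0"
  assumes "n \<ge> 1"
  shows "tree_poly n y t = (\<Sum>k=0..(n - 1) div 2.
    1 / of_nat (k + 1) * of_nat ((2 * k) choose k) * of_nat ((n - 1) choose (2 * k))
    * y ^ (k + 1) * t ^ (k + 1) * (1 + t) ^ (n - 2 * k - 1))"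
proof -
  obtain m where n: "n = Suc m"
    using assms by (cases n) auto
  define E where "E = fps_X * inverse (1 - fps_const (1 + t) * fps_X)"
  have E: "fps_nth (E ^ Suc j) (Suc m) = of_nat (m choose j) * (1 + t) ^ (m - j)" for j
    unfolding E_def by (rule geometric_fps_power_nth)
  have even_power: "(E ^ 2) ^ k = E ^ (2 * k)" for k
    by (simp only: power_mult)
  have "fps_const t * E * (fps_const (y * t) * E ^ 2) ^ k =
      fps_const (t * (y * t) ^ k) * E ^ Suc (2 * k)" for k
    by (simp only: power_mult_distrib even_power fps_const_power power_Suc mult_ac
        flip: fps_const_mult)
  then have summand: "fps_nth (fps_const t * E * (fps_const (y * t) * E ^ 2) ^ k) (Suc m) =
      t * (y * t) ^ k * (of_nat (m choose (2 * k)) * (1 + t) ^ (m - 2 * k))" for k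
    by (simp only: fps_mult_left_const_nth E)
  \<comment> \<open>The extra \<open>y\<close> is the \<open>+ 1\<close> in the exponent
    \<open>tc T + 1\<close>.\<close>
  have "tree_poly n y t = y * fps_nth (tree_fps y t) n"
    by (simp add: n tree_poly_def tree_fps_def tree_weight_def sum_distrib_left mult_ac)
  also have "tree_fps y t = fps_const t * E * (catalan_fps oo (fps_const (y * t) * E ^ 2))"
    unfolding E_def by (rule tree_fps_closed_form)
  also have "fps_nth \<dots> n = (\<Sum>k=0..n. fps_nth catalan_fps k *
      (t * (y * t) ^ k * (of_nat (m choose (2 * k)) * (1 + t) ^ (m - 2 * k))))"
    by (subst fps_mult_compose_nth) (simp_all only: n summand, simp add: E_def power2_eq_square)
  \<comment> \<open>Beyond \<open>m div 2\<close> the factor \<open>m choose (2 * k)\<close>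
    vanishes.\<close>
  also have "\<dots> = (\<Sum>k=0..m div 2. fps_nth catalan_fps k *
      (t * (y * t) ^ k * (of_nat (m choose (2 * k)) * (1 + t) ^ (m - 2 * k))))"
    by (intro sum.mono_neutral_right) (auto simp: n binomial_eq_0)
  finally show ?thesis
    by (simp add: n catalan_fps_def sum_distrib_left power_mult_distrib mult_ac)
qed

section \<open>Coefficients of the tree polynomial and the Narayana numbers\<close>

text \<open>The guard \<open>c \<le> j\<close> is needed because \<open>j - c\<close> truncates to 0
  for smaller \<open>j\<close>. The free bound \<open>N\<close> lets all summands of the closed form
  share one range.\<close>

lemma shifted_binomial_expansion:
  fixes t :: "'a::comm_semiring_1"
  assumes "a + c \<le> N"
  shows "t ^ c * (1 + t) ^ a =
    (\<Sum>j\<le>N. of_nat (if c \<le> j then a choose (j - c) else 0) * t ^ j)"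
proof -
  have "t ^ c * (1 + t) ^ a = (\<Sum>i\<le>a. of_nat (a choose i) * t ^ (i + c))"
    using binomial_ring[of t 1 a] by (simp add: sum_distrib_left power_add mult_ac add.commute)
  also have "\<dots> = (\<Sum>j=0+c..a+c. of_nat (a choose (j - c)) * t ^ j)"
    by (subst sum.shift_bounds_cl_nat_ivl) (simp add: atLeast0AtMost)
  also have "\<dots> = (\<Sum>j\<le>N. of_nat (if c \<le> j then a choose (j - c) else 0) * t ^ j)"
    using assms by (intro sum.mono_neutral_cong_left) (auto simp: binomial_eq_0)
  finally show ?thesis .
qed

text \<open>The coefficient of \<open>y ^ (k + 1) * t ^ j\<close> in the tree polynomial, which is
  the claimed number of trees.\<close>

definition tree_coeff :: "nat \<Rightarrow> nat \<Rightarrow> nat \<Rightarrow> 'a::field_char_0" where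
  "tree_coeff n k j = 1 / of_nat (k + 1) * of_nat ((2 * k) choose k)
     * of_nat ((n - 1) choose (2 * k))
     * of_nat (if k + 1 \<le> j then (n - 2 * k - 1) choose (j - (k + 1)) else 0)"

lemma tree_poly_expansion:
  fixes y t :: "'a::field_char_0"
  assumes "n \<ge> 1"
  shows "tree_poly n y t = (\<Sum>k\<le>n. (\<Sum>j\<le>n. tree_coeff n k j * t ^ j) * y ^ (k + 1))"
proof -
  have "tree_poly n y t = (\<Sum>k=0..(n - 1) div 2.
      (\<Sum>j\<le>n. tree_coeff n k j * t ^ j) * y ^ (k + 1))"
    unfolding tree_poly_closed_form[OF assms]
  proof (rule sum.cong[OF refl])
    fix k assume "k \<in> {0..(n - 1) div 2}"
    then have "n - 2 * k - 1 + (k + 1) \<le> n"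
      using assms by auto
    note e = shifted_binomial_expansion[OF this, of t]
    have "1 / of_nat (k + 1) * of_nat ((2 * k) choose k) * of_nat ((n - 1) choose (2 * k))
        * y ^ (k + 1) * t ^ (k + 1) * (1 + t) ^ (n - 2 * k - 1)
      = 1 / of_nat (k + 1) * of_nat ((2 * k) choose k) * of_nat ((n - 1) choose (2 * k))
        * (t ^ (k + 1) * (1 + t) ^ (n - 2 * k - 1)) * y ^ (k + 1)"
      by (simp only: mult_ac)
    also have "\<dots> = (\<Sum>j\<le>n. tree_coeff n k j * t ^ j) * y ^ (k + 1)"
      unfolding e tree_coeff_def by (simp only: sum_distrib_left mult.assoc)
    finally show "1 / of_nat (k + 1) * of_nat ((2 * k) choose k) * of_nat ((n - 1) choose (2 * k))
        * y ^ (k + 1) * t ^ (k + 1) * (1 + t) ^ (n - 2 * k - 1)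
      = (\<Sum>j\<le>n. tree_coeff n k j * t ^ j) * y ^ (k + 1)" .
  qed
  also have "\<dots> = (\<Sum>k\<le>n. (\<Sum>j\<le>n. tree_coeff n k j * t ^ j) * y ^ (k + 1))"
    using assms by (intro sum.mono_neutral_left) (auto simp: tree_coeff_def binomial_eq_0)
  finally show ?thesis .
qed

text \<open>With \<open>a = j - k - 1\<close> and \<open>b = n - j - k\<close>, both sides equal
  \<open>n! / (k! (k + 1)! a! b!)\<close>. The right-hand form isolates the dependence on
  \<open>k\<close> in a Vandermonde summand.\<close>

lemma tree_coeff_eq:
  assumes "1 \<le> j" "j \<le> n"
  shows "of_nat n * tree_coeff n k j =
    (of_nat ((n choose j) * ((j choose (k + 1)) * ((n - j) choose k))) :: 'a::field_char_0)"
proof (cases "k + 1 \<le> j \<and> k \<le> n - j")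
  case True
  define a where "a = j - (k + 1)"
  define b where "b = n - j - k"
  have j: "j = k + 1 + a" and n: "n = Suc (2 * k + (a + b))" and nj: "n - j = k + b"
    using True assms by (auto simp: a_def b_def)
  have factorials:
    "of_nat ((2 * k) choose k) = (fact (2 * k) / (fact k * fact k) :: 'a)"
    "of_nat ((2 * k + (a + b)) choose (2 * k)) =
      (fact (2 * k + (a + b)) / (fact (2 * k) * fact (a + b)) :: 'a)"
    "of_nat ((a + b) choose a) = (fact (a + b) / (fact a * fact b) :: 'a)"
    "of_nat (n choose j) = (fact n / (fact j * fact (k + b)) :: 'a)"
    "of_nat (j choose (k + 1)) = (fact j / (fact (k + 1) * fact a) :: 'a)"
    "of_nat ((k + b) choose k) = (fact (k + b) / (fact k * fact b) :: 'a)"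
    using binomial_fact[of k "2 * k", where 'a = 'a]
      binomial_fact[of "2 * k" "2 * k + (a + b)", where 'a = 'a]
      binomial_fact[of a "a + b", where 'a = 'a] binomial_fact[of j n, where 'a = 'a]
      binomial_fact[of "k + 1" j, where 'a = 'a] binomial_fact[of k "k + b", where 'a = 'a]
      assms nj j by (simp_all add: mult_2)
  have fact_Suc: "fact n = (of_nat n * fact (2 * k + (a + b)) :: 'a)"
    "fact (k + 1) = (of_nat (k + 1) * fact k :: 'a)"
    unfolding n by (simp_all only: fact_Suc Suc_eq_plus1[symmetric])
  have "of_nat n * tree_coeff n k j = (of_nat n * (1 / of_nat (k + 1)
      * of_nat ((2 * k) choose k) * of_nat ((2 * k + (a + b)) choose (2 * k))
      * of_nat ((a + b) choose a)) :: 'a)"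
    by (simp add: tree_coeff_def n j)
  also have "\<dots> = of_nat (n choose j) * (of_nat (j choose (k + 1)) * of_nat ((k + b) choose k))"
    unfolding factorials fact_Suc using of_nat_neq_0[of k, where 'a = 'a]
    by (simp add: divide_simps)
  finally show ?thesis
    by (simp only: nj of_nat_mult)
next
  \<comment> \<open>Both sides vanish. If \<open>2 * k > n - 1\<close>, truncated subtraction spoils
    the last binomial, but \<open>(n - 1) choose (2 * k)\<close> is 0.\<close>
  case False
  then show ?thesis
    using assms by (cases "2 * k \<le> n - 1") (auto simp: tree_coeff_def binomial_eq_0)
qed

text \<open>After reflecting \<open>j choose (k + 1)\<close> to \<open>j choose (j - 1 - k)\<close>,
  the sum over \<open>k\<close> is Vandermonde's convolution for \<open>(n - j) + j\<close>; the
  result is a Narayana number.\<close>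

lemma sum_tree_coeff:
  assumes "1 \<le> j" "j \<le> n"
  shows "(\<Sum>k\<le>n. tree_coeff n k j) =
    (1 / of_nat n * (of_nat (n choose j) * of_nat (n choose (j - 1))) :: 'a::field_char_0)"
proof -
  have "(\<Sum>k\<le>n. (j choose (k + 1)) * ((n - j) choose k)) =
      (\<Sum>k\<le>j - 1. ((n - j) choose k) * (j choose (j - 1 - k)))"
  proof (rule sum.mono_neutral_cong_right)
    fix k assume "k \<in> {..j - 1}"
    then show "(j choose (k + 1)) * ((n - j) choose k) = ((n - j) choose k) * (j choose (j - 1 - k))"
      using assms binomial_symmetric[of "k + 1" j] by (simp add: mult.commute)
  qed (use assms in \<open>auto simp: binomial_eq_0\<close>)
  also have "\<dots> = n choose (j - 1)"
    using vandermonde[of "n - j" j "j - 1"] assms by simp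
  finally have vdm: "(\<Sum>k\<le>n. (j choose (k + 1)) * ((n - j) choose k)) = n choose (j - 1)" .
  have "of_nat n * (\<Sum>k\<le>n. tree_coeff n k j) =
      (of_nat ((n choose j) * (\<Sum>k\<le>n. (j choose (k + 1)) * ((n - j) choose k))) :: 'a)"
    by (simp only: sum_distrib_left tree_coeff_eq[OF assms] of_nat_sum)
  moreover have "(of_nat n :: 'a) \<noteq> 0"
    using assms by simp
  ultimately show ?thesis
    unfolding vdm by (simp add: field_simps)
qed

lemma narayana_eq_tree_poly:
  fixes t :: "'a::field_char_0"
  assumes "n \<ge> 1"
  shows "narayana n t = tree_poly n 1 t"
proof -
  have "tree_poly n 1 t = (\<Sum>j\<le>n. (\<Sum>k\<le>n. tree_coeff n k j) * t ^ j)"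
    unfolding tree_poly_expansion[OF assms]
    by (subst sum_distrib_right) (subst sum.swap, simp add: sum_distrib_right)
  \<comment> \<open>The term \<open>j = 0\<close> drops out by the guard in
    \<open>tree_coeff\<close>.\<close>
  also have "\<dots> = (\<Sum>j=1..n. (\<Sum>k\<le>n. tree_coeff n k j) * t ^ j)"
    by (rule sum.mono_neutral_right) (auto simp: tree_coeff_def not_le)
  also have "\<dots> = narayana n t"
    unfolding narayana_def sum_distrib_left
    by (intro sum.cong refl) (simp add: sum_tree_coeff)
  finally show ?thesis
    by simp
qed

section \<open>Change of variables\<close>

text \<open>Stated over an arbitrary field to serve both identities: the first with
  \<open>u\<close>, \<open>v\<close> the two indeterminates, the second with the series
  \<open>ser_u\<close>, \<open>ser_v\<close>.\<close>

lemma tree_poly_change_of_variables: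
  fixes u v :: "'a::field_char_0"
  assumes "n \<ge> 1" and nz: "u + v \<noteq> 0" "1 + u * v \<noteq> 0"
  shows "tree_poly n ((1 + u) ^ 2 * v / ((u + v) * (1 + u * v))) ((u + v) / (1 + u * v)) =
    ((1 + u) / (1 + u * v)) ^ (n + 1) * narayana n v"
proof -
  define y t q where "y = (1 + u) ^ 2 * v / ((u + v) * (1 + u * v))"
    and "t = (u + v) / (1 + u * v)" and "q = (1 + u) / (1 + u * v)"
  have yt: "y * t = q ^ 2 * v"
    using nz by (simp add: y_def t_def q_def power_divide power2_eq_square)
  have t: "1 + t = q * (1 + v)"
    using nz by (simp add: t_def q_def field_simps)
  have "y ^ (k + 1) * t ^ (k + 1) * (1 + t) ^ (n - 2 * k - 1) =
      q ^ (n + 1) * (v ^ (k + 1) * (1 + v) ^ (n - 2 * k - 1))"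
    if "k \<in> {0..(n - 1) div 2}" for k
  proof -
    \<comment> \<open>The total power of \<open>q\<close> is the same for every \<open>k\<close>;
      the subtraction is exact on the range of summation.\<close>
    have "2 * (k + 1) + (n - 2 * k - 1) = n + 1"
      using that assms(1) by auto
    then have q: "q ^ (n + 1) = (q ^ 2) ^ (k + 1) * q ^ (n - 2 * k - 1)"
      by (metis power_add power_mult)
    have "y ^ (k + 1) * t ^ (k + 1) * (1 + t) ^ (n - 2 * k - 1) =
        (q ^ 2 * v) ^ (k + 1) * (q * (1 + v)) ^ (n - 2 * k - 1)"
      by (simp only: yt[symmetric] t power_mult_distrib)
    then show ?thesis
      by (simp only: q power_mult_distrib mult_ac)
  qed
  then have "tree_poly n y t = q ^ (n + 1) * tree_poly n 1 v"
    unfolding tree_poly_closed_form[OF assms(1)] sum_distrib_left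
    by (intro sum.cong refl) (simp add: mult.assoc mult.left_commute)
  then show ?thesis
    by (simp add: narayana_eq_tree_poly[OF assms(1)] y_def t_def q_def)
qed

section \<open>Counting trees by comparing coefficients\<close>

text \<open>Polynomials agreeing at every point of an infinite domain are equal. Several indices may
  share an exponent, so that the index set can be a set of trees.\<close>

lemma power_sum_coeffs_eq:
  fixes a :: "'i \<Rightarrow> 'a::{idom, ring_char_0}"
  assumes "finite I" "finite J"
    and eq: "\<And>x. (\<Sum>i\<in>I. a i * x ^ p i) = (\<Sum>j\<in>J. b j * x ^ q j)"
  shows "(\<Sum>i | i \<in> I \<and> p i = k. a i) = (\<Sum>j | j \<in> J \<and> q j = k. b j)"
proof -
  have "poly (\<Sum>i\<in>I. monom (a i) (p i)) = poly (\<Sum>j\<in>J. monom (b j) (q j))"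
    using eq by (auto simp: poly_sum poly_monom)
  then have "coeff (\<Sum>i\<in>I. monom (a i) (p i)) k = coeff (\<Sum>j\<in>J. monom (b j) (q j)) k"
    by (simp add: poly_eq_poly_eq_iff)
  then show ?thesis
    using assms by (simp add: coeff_sum sum.If_cases Int_def)
qed

text \<open>Coefficients are compared twice: first in \<open>y\<close> for each fixed
  \<open>t\<close>, at exponent \<open>k + 1\<close>, and then in \<open>t\<close>.\<close>

lemma card_tc_nlc:
  fixes k j :: nat
  assumes "n \<ge> 1"
  shows "of_nat (card {T \<in> binary_trees n. tc T = k \<and> nlc T = j}) = (tree_coeff n k j :: rat)"
proof -
  have "(\<Sum>T\<in>binary_trees n. t ^ nlc T * y ^ (tc T + 1)) =
      (\<Sum>k\<le>n. (\<Sum>j\<le>n. tree_coeff n k j * t ^ j) * y ^ (k + 1))" for y t :: rat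
    using tree_poly_expansion[OF assms, of y t] by (simp add: tree_poly_def mult_ac)
  note power_sum_coeffs_eq[OF finite_binary_trees finite_atMost this, where k = "k + 1"]
  then have "(\<Sum>T | T \<in> binary_trees n \<and> tc T = k. t ^ nlc T) =
      (\<Sum>l | l \<le> n \<and> l = k. \<Sum>j\<le>n. tree_coeff n l j * t ^ j)" for t :: rat
    by simp
  moreover have "{l. l \<le> n \<and> l = k} = (if k \<le> n then {k} else {})"
    by auto
  moreover have "k > n \<Longrightarrow> tree_coeff n k j = (0::rat)" for j
    by (simp add: tree_coeff_def binomial_eq_0)
  \<comment> \<open>The explicit coefficient 1 makes the second comparison produce a sum of ones,
    hence a cardinality.\<close>
  ultimately have "(\<Sum>T | T \<in> binary_trees n \<and> tc T = k. 1 * t ^ nlc T) =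
      (\<Sum>j\<le>n. tree_coeff n k j * t ^ j)" for t :: rat
    by auto
  from power_sum_coeffs_eq[OF _ finite_atMost this, where k = j]
  have "of_nat (card {T \<in> binary_trees n. tc T = k \<and> nlc T = j}) =
      (\<Sum>i | i \<le> n \<and> i = j. tree_coeff n k i :: rat)"
    by (simp add: finite_binary_trees conj_assoc)
  moreover have "{i. i \<le> n \<and> i = j} = (if j \<le> n then {j} else {})"
    by auto
  moreover have "j > n \<Longrightarrow> tree_coeff n k j = (0::rat)"
    using assms by (cases "2 * k \<le> n - 1") (auto simp: tree_coeff_def binomial_eq_0)
  ultimately show ?thesis
    by auto
qed

text \<open>For \<open>2 * k > n - 1\<close> the upper argument of \<open>int_binomial\<close> is
  negative and its value can be nonzero; the factor \<open>(n - 1) choose (2 * k)\<close> then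
  annihilates it.\<close>

lemma tree_coeff_int_binomial:
  assumes "n \<ge> 1"
  shows "tree_coeff n k j =
    1 / of_nat (k + 1) * of_nat ((2 * k) choose k) * of_nat ((n - 1) choose (2 * k))
    * int_binomial (int n - 2 * int k - 1) (int j - int k - 1)"
proof (cases "2 * k \<le> n - 1")
  case True
  have "int_binomial (int n - 2 * int k - 1) (int j - int k - 1) =
      of_nat (if k + 1 \<le> j then (n - 2 * k - 1) choose (j - (k + 1)) else 0)"
  proof (cases "k + 1 \<le> j")
    case True
    then have "nat (int j - int k - 1) = j - (k + 1)"
      by simp
    moreover have "int n - 2 * int k - 1 = int (n - 2 * k - 1)"
      using assms \<open>2 * k \<le> n - 1\<close> by simp
    ultimately show ?thesis
      using True by (simp add: int_binomial_def binomial_gbinomial)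
  qed (auto simp: int_binomial_def)
  then show ?thesis
    by (simp add: tree_coeff_def)
qed (simp add: tree_coeff_def binomial_eq_0)

section \<open>The series \<open>u\<close> and \<open>v\<close>\<close>

text \<open>Both stages of the embedding, \<open>to_fract\<close> on coefficients and the inclusion
  into Laurent series, are injective ring homomorphisms.\<close>

lemma embed_series_add: "embed_series (f + g) = embed_series f + embed_series g"
  and embed_series_diff: "embed_series (f - g) = embed_series f - embed_series g"
  and embed_series_mult: "embed_series (f * g) = embed_series f * embed_series g"
  and embed_series_1: "embed_series 1 = 1"
  and embed_series_eq_iff: "embed_series f = embed_series g \<longleftrightarrow> f = g"
proof -
  define h :: "rat poly fps \<Rightarrow> rat poly fract fps" where
    "h f = Abs_fps (\<lambda>i. to_fract (fps_nth f i))" for f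
  have e: "embed_series f = fps_to_fls (h f)" for f
    by (simp add: embed_series_def h_def)
  have h: "h (f + g) = h f + h g" "h (f - g) = h f - h g" "h (f * g) = h f * h g" "h 1 = 1"
    by (auto intro!: fps_ext simp: h_def fps_mult_nth)
  then show "embed_series (f + g) = embed_series f + embed_series g"
    "embed_series (f - g) = embed_series f - embed_series g"
    "embed_series (f * g) = embed_series f * embed_series g" "embed_series 1 = 1"
    by (simp_all add: e fls_times_fps_to_fls)
  show "embed_series f = embed_series g \<longleftrightarrow> f = g"
    by (auto simp: e h_def fps_eq_iff)
qed

lemma embed_series_numeral: "embed_series (numeral w) = numeral w"
  by (induction w) (simp_all only: numeral.simps embed_series_1 embed_series_add)

lemma embed_series_power: "embed_series (f ^ k) = embed_series f ^ k"
  by (induction k) (simp_all add: embed_series_1 embed_series_mult)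

lemma fps_unit:
  fixes f :: "'a::comm_ring_1 fps"
  assumes "fps_nth f 0 * c = 1"
  obtains g where "f * g = 1"
  using assms fps_right_inverse[OF assms] by blast


text \<open>Rationalizing the numerators of \<open>u\<close> and \<open>v\<close> exhibits them as rational functions of \<open>s\<close> and \<open>t\<close>.\<close>

lemma uv_parametrization:
  fixes s t y :: "'a::field_char_0"
  defines "u \<equiv> (1 + t ^ 2 - 2 * y * t - (1 - t) * s) / (2 * (1 - y) * t)"
    and "v \<equiv> ((1 + t) ^ 2 - 2 * y * t - (1 + t) * s) / (2 * y * t)"
  assumes s2: "s ^ 2 = (1 + t) ^ 2 - 4 * y * t"
    and nz: "t \<noteq> 0" "y \<noteq> 0" "y \<noteq> 1" "s \<noteq> 0"
  shows "u = (s - 1 + t) / (s + 1 - t)" "v = (1 + t - s) / (1 + t + s)"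
    "u + v \<noteq> 0" "1 + u * v \<noteq> 0"
    "(1 + u) ^ 2 * v / ((u + v) * (1 + u * v)) = y" "(u + v) / (1 + u * v) = t"
proof -
  \<comment> \<open>Differences of squares factor the denominators of \<open>v\<close> and
    \<open>u\<close>; twice each numerator is the square of one of the factors, which therefore
    cancels.\<close>
  have y4: "4 * y * t = (1 + t - s) * (1 + t + s)"
    using s2 by (simp add: algebra_simps power2_eq_square)
  have y4': "4 * (1 - y) * t = (s - 1 + t) * (s + 1 - t)"
    using s2 by (simp add: algebra_simps power2_eq_square)
  define p q where "p = s + 1 - t" and "q = 1 + t + s"
  have p: "p \<noteq> 0" and q: "q \<noteq> 0"
    using y4 y4' nz unfolding p_def q_def by (metis mult_zero_right mult_eq_0_iff
        zero_neq_numeral right_minus_eq)+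
  have "2 * (1 + t ^ 2 - 2 * y * t - (1 - t) * s) = (s - 1 + t) * (s - 1 + t)"
    using s2 by (simp add: algebra_simps power2_eq_square)
  moreover have "u = (2 * (1 + t ^ 2 - 2 * y * t - (1 - t) * s)) / (2 * (2 * (1 - y) * t))"
    unfolding u_def by (rule mult_divide_mult_cancel_left[symmetric]) simp
  moreover have "2 * (2 * (1 - y) * t) = (s - 1 + t) * p" "2 * (2 * (1 - y) * t) \<noteq> 0"
    using nz by (simp_all add: p_def flip: y4')
  ultimately show u: "u = (s - 1 + t) / (s + 1 - t)"
    by (metis mult_divide_mult_cancel_left mult_eq_0_iff p_def)
  have "2 * ((1 + t) ^ 2 - 2 * y * t - (1 + t) * s) = (1 + t - s) * (1 + t - s)"
    using s2 by (simp add: algebra_simps power2_eq_square)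
  moreover have "v = (2 * ((1 + t) ^ 2 - 2 * y * t - (1 + t) * s)) / (2 * (2 * y * t))"
    unfolding v_def by (rule mult_divide_mult_cancel_left[symmetric]) simp
  moreover have "2 * (2 * y * t) = (1 + t - s) * q" "2 * (2 * y * t) \<noteq> 0"
    using nz by (simp_all add: q_def flip: y4)
  ultimately show v: "v = (1 + t - s) / (1 + t + s)"
    by (metis mult_divide_mult_cancel_left mult_eq_0_iff q_def)
  have up: "u * p = s - 1 + t" and vq: "v * q = 1 + t - s"
    using u v p q unfolding p_def q_def by simp_all
  have pq: "p * q \<noteq> 0"
    using p q by simp
  have "(u + v) * (p * q) = (u * p) * q + (v * q) * p"
    by (simp add: algebra_simps)
  also have "\<dots> = 4 * s * t"
    unfolding up vq by (simp add: p_def q_def algebra_simps)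
  finally have uv: "u + v = 4 * s * t / (p * q)"
    using pq by (simp only: nonzero_eq_divide_eq simp_thms)
  have "(1 + u * v) * (p * q) = p * q + (u * p) * (v * q)"
    by (simp add: algebra_simps)
  also have "\<dots> = 4 * s"
    unfolding up vq by (simp add: p_def q_def algebra_simps)
  finally have uv1: "1 + u * v = 4 * s / (p * q)"
    using pq by (simp only: nonzero_eq_divide_eq simp_thms)
  show "u + v \<noteq> 0" "1 + u * v \<noteq> 0"
    unfolding uv uv1 using nz p q by simp_all
  show "(u + v) / (1 + u * v) = t"
    unfolding uv uv1 using nz p q by simp
  have "(1 + u) * p = p + u * p"
    by (simp add: algebra_simps)
  also have "\<dots> = 2 * s"
    unfolding up by (simp add: p_def)
  finally have up1: "(1 + u) * p = 2 * s" .
  have vqq: "(v * q) * q = 4 * y * t"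
    unfolding vq by (simp only: y4 q_def)
  \<comment> \<open>The second \<open>q\<close> completes \<open>v * q = 1 + t - s\<close> to the
    factorization of \<open>4 * y * t\<close>.\<close>
  have "(1 + u) ^ 2 * v * (p * q) ^ 2 = ((1 + u) * p) ^ 2 * ((v * q) * q)"
    by (simp only: power_mult_distrib power2_eq_square mult_ac)
  also have "\<dots> = y * (16 * s ^ 2 * t)"
    unfolding up1 vqq by (simp add: power_mult_distrib)
  finally have num: "(1 + u) ^ 2 * v * (p * q) ^ 2 = y * (16 * s ^ 2 * t)" .
  have "(u + v) * (1 + u * v) = 16 * s ^ 2 * t / (p * q) ^ 2"
    unfolding uv uv1 by (simp add: power2_eq_square)
  then have "(1 + u) ^ 2 * v / ((u + v) * (1 + u * v)) =
      (1 + u) ^ 2 * v * (p * q) ^ 2 / (16 * s ^ 2 * t)"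
    by simp
  also have "\<dots> = y"
    unfolding num using nz by simp
  finally show "(1 + u) ^ 2 * v / ((u + v) * (1 + u * v)) = y" .
qed

text \<open>The rationalized denominators have constant term 2, a unit of \<open>rat poly\<close>,
  so they are invertible among the series over \<open>rat poly\<close>; the original denominators
  are divisible by \<open>t\<close> and are not.\<close>

lemma ser_sqrt_squared: "ser_sqrt ^ 2 = (1 + ser_t) ^ 2 - 4 * ser_y * ser_t"
  and ser_t_nonzero: "ser_t \<noteq> 0"
  and ser_y_nonzero: "ser_y \<noteq> 0"
  and ser_y_not_1: "ser_y \<noteq> 1"
  and ser_sqrt_nonzero: "ser_sqrt \<noteq> 0"
  and ser_denominators_invertible:
    "\<exists>w. (ser_sqrt + 1 - ser_t) * embed_series w = 1"
    "\<exists>w. (1 + ser_t + ser_sqrt) * embed_series w = 1"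
  and ser_sqrt_range: "ser_sqrt \<in> range embed_series"
proof -
  define f :: "rat poly fps" where "f = (1 + fps_X) ^ 2 - 4 * fps_const [:0, 1:] * fps_X"
  define s where "s = fps_sqrt1 f"
  note embed = embed_series_add embed_series_diff embed_series_mult embed_series_1
    embed_series_numeral embed_series_power
  have "fps_nth f 0 = 1"
    by (simp add: f_def power2_eq_square)
  from theI'[OF fps_sqrt1_unique_existence[OF this]]
  have s: "s ^ 2 = f" "fps_nth s 0 = 1"
    by (simp_all add: s_def fps_sqrt1_def)
  have S: "ser_sqrt = embed_series s"
    by (simp add: ser_sqrt_def s_def f_def)
  then show "ser_sqrt \<in> range embed_series"
    by simp
  show "ser_sqrt ^ 2 = (1 + ser_t) ^ 2 - 4 * ser_y * ser_t"
    unfolding S embed_series_power[symmetric] s(1) f_def by (simp only: embed ser_t_def ser_y_def)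
  have embed_0: "embed_series 0 = 0"
    using embed_series_diff[of 0 0] by simp
  show "ser_t \<noteq> 0" "ser_y \<noteq> 0" "ser_y \<noteq> 1" "ser_sqrt \<noteq> 0"
    unfolding S ser_t_def ser_y_def embed_0[symmetric] embed_series_1[symmetric] embed_series_eq_iff
    using s(2) by (auto simp: one_pCons simp flip: fps_const_1_eq_1)
  have two: "2 * [:1 / 2:] = (1 :: rat poly)"
    by (simp add: numeral_poly one_pCons)
  obtain w where "(s + 1 - fps_X) * w = 1"
    by (rule fps_unit[of "s + 1 - fps_X" "[:1 / 2:]"]) (use s(2) two in simp_all)
  then show "\<exists>w. (ser_sqrt + 1 - ser_t) * embed_series w = 1"
    unfolding S ser_t_def by (metis embed_series_mult embed_series_add embed_series_diff embed_series_1)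
  obtain w where "(1 + fps_X + s) * w = 1"
    by (rule fps_unit[of "1 + fps_X + s" "[:1 / 2:]"]) (use s(2) two in simp_all)
  then show "\<exists>w. (1 + ser_t + ser_sqrt) * embed_series w = 1"
    unfolding S ser_t_def by (metis embed_series_mult embed_series_add embed_series_1)
qed

lemma range_embed_series_closed:
  assumes "a \<in> range embed_series" "b \<in> range embed_series"
  shows "a + b \<in> range embed_series" "a - b \<in> range embed_series" "a * b \<in> range embed_series"
  using assms by (auto simp flip: embed_series_add embed_series_diff embed_series_mult)

lemma divide_mem_range_embed_series:
  assumes "a \<in> range embed_series" "\<exists>w. b * embed_series w = 1"
  shows "a / b \<in> range embed_series"
proof -
  obtain w where w: "b * embed_series w = 1"
    using assms by blast
  then have "a / b = a * embed_series w"
    by (metis divide_inverse inverse_unique)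
  then show ?thesis
    using assms(1) range_embed_series_closed(3) by auto
qed

theorem corollary5p8:
  fixes n :: nat
  assumes "n \<ge> 1"
  shows
    "(let y = ratfun_y; t = ratfun_t in
        narayana n t =
          ((1 + y * t) / (1 + y)) ^ (n + 1)
          * tree_poly n ((1 + y) ^ 2 * t / ((y + t) * (1 + y * t))) ((y + t) / (1 + y * t)))
     \<and> (ser_u \<in> range embed_series \<and> ser_v \<in> range embed_series
        \<and> tree_poly n ser_y ser_t =
            ((1 + ser_u) / (1 + ser_u * ser_v)) ^ (n + 1) * narayana n ser_v)
     \<and> (let y = ratfun_y; t = ratfun_t in
        tree_poly n y t =
          (\<Sum>k=0..(n - 1) div 2.
             1 / of_nat (k + 1) * of_nat ((2 * k) choose k) * of_nat ((n - 1) choose (2 * k))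
             * y ^ (k + 1) * t ^ (k + 1) * (1 + t) ^ (n - 2 * k - 1)))
     \<and> (\<forall>k j :: nat.
        of_nat (card {T \<in> binary_trees n. tc T = k \<and> nlc T = j}) =
          1 / of_nat (k + 1) * of_nat ((2 * k) choose k) * of_nat ((n - 1) choose (2 * k))
          * int_binomial (int n - 2 * int k - 1) (int j - int k - 1))"
proof (intro conjI)
  let ?y = ratfun_y and ?t = ratfun_t
  have "?y + ?t = to_fract [:[:0, 1:], 1:]" "1 + ?y * ?t = to_fract [:1, [:0, 1:]:]"
    "1 + ?y = to_fract [:[:1, 1:]:]"
    unfolding ratfun_y_def ratfun_t_def to_fract_1[symmetric] to_fract_add[symmetric]
      to_fract_mult[symmetric] to_fract_eq_iff
    by (simp_all add: one_pCons)
  then have nz: "?y + ?t \<noteq> 0" "1 + ?y * ?t \<noteq> 0" "1 + ?y \<noteq> 0"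
    by simp_all
  \<comment> \<open>The prefactor of the first identity undoes the one from the change of
    variables.\<close>
  then have inv: "((1 + ?y * ?t) / (1 + ?y)) ^ (n + 1) * ((1 + ?y) / (1 + ?y * ?t)) ^ (n + 1) = 1"
    by (simp flip: power_mult_distrib)
  show "let y = ratfun_y; t = ratfun_t in
        narayana n t =
          ((1 + y * t) / (1 + y)) ^ (n + 1)
          * tree_poly n ((1 + y) ^ 2 * t / ((y + t) * (1 + y * t))) ((y + t) / (1 + y * t))"
    unfolding Let_def tree_poly_change_of_variables[OF assms nz(1,2)]
    by (simp only: mult.assoc[symmetric] inv mult_1_left)
next
  note uv = uv_parametrization[OF ser_sqrt_squared ser_t_nonzero ser_y_nonzero ser_y_not_1
      ser_sqrt_nonzero, folded ser_u_def ser_v_def]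
  have mem: "1 \<in> range embed_series" "ser_t \<in> range embed_series"
    using embed_series_1 by (auto simp: ser_t_def intro: range_eqI[OF sym])
  show "ser_u \<in> range embed_series" "ser_v \<in> range embed_series"
    \<comment> \<open>Only the rationalized quotients have denominators invertible in the range of
      \<open>embed_series\<close>.\<close>
    unfolding uv(1,2)
    by (intro divide_mem_range_embed_series ser_denominators_invertible
        range_embed_series_closed mem ser_sqrt_range)+
  show "tree_poly n ser_y ser_t =
      ((1 + ser_u) / (1 + ser_u * ser_v)) ^ (n + 1) * narayana n ser_v"
    using tree_poly_change_of_variables[OF assms uv(3,4)] unfolding uv(5,6) .
next
  show "let y = ratfun_y; t = ratfun_t in
        tree_poly n y t =
          (\<Sum>k=0..(n - 1) div 2.
             1 / of_nat (k + 1) * of_nat ((2 * k) choose k) * of_nat ((n - 1) choose (2 * k))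
             * y ^ (k + 1) * t ^ (k + 1) * (1 + t) ^ (n - 2 * k - 1))"
    unfolding Let_def by (rule tree_poly_closed_form[OF assms])
next
  show "\<forall>k j :: nat.
        of_nat (card {T \<in> binary_trees n. tc T = k \<and> nlc T = j}) =
          1 / of_nat (k + 1) * of_nat ((2 * k) choose k) * of_nat ((n - 1) choose (2 * k))
          * int_binomial (int n - 2 * int k - 1) (int j - int k - 1)"
    by (simp only: card_tc_nlc[OF assms] tree_coeff_int_binomial[OF assms] simp_thms)
qed

end
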